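(* Let $X$ be a finite connected poset with $|X|>1$ and let $K$ be a field. Then the set of regular Hom-Lie structures on $I(X,K)$ is a normal subgroup of the group (under composition) of all Lie automorphisms of $I(X,K)$.
   Context: $I(X,K)$ is the incidence algebra: the $K$-algebra with basis $\{e_{xy}: x\le y\}$ and product $e_{xy}e_{uv}=e_{xv}$ if $y=u$ and $0$ otherwise. It is regarded as a Lie algebra with $[f,g]=fg-gf$; a Lie automorphism is a linear bijection preserving $[\cdot,\cdot]$. A regular Hom-Lie structure on a Lie algebra $L$ is an automorphism $\varphi$ of the Lie algebra $L$ satisfying $[[a,b],\varphi(c)]+[[b,c],\varphi(a)]+[[c,a],\varphi(b)]=0$ for all $a,b,c\in L$. *)

theory Defs
  imports "HOL.Vector_Spaces" "HOL-Algebra.Coset"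
begin

locale lie_algebra = vector_space scale
  for scale :: "'k::field \<Rightarrow> 'a::ab_group_add \<Rightarrow> 'a" +
  fixes bracket :: "'a \<Rightarrow> 'a \<Rightarrow> 'a"
  assumes bracket_add_left: "bracket (a + b) c = bracket a c + bracket b c"
    and bracket_add_right: "bracket a (b + c) = bracket a b + bracket a c"
    and bracket_scale_left: "bracket (scale r a) b = scale r (bracket a b)"
    and bracket_scale_right: "bracket a (scale r b) = scale r (bracket a b)"
    and bracket_self: "bracket a a = 0"
    and jacobi: "bracket (bracket a b) c + bracket (bracket b c) a + bracket (bracket c a) b = 0"
begin

definition lie_automorphism :: "('a \<Rightarrow> 'a) \<Rightarrow> bool" where
  "lie_automorphism \<phi> \<longleftrightarrow> Vector_Spaces.linear scale scale \<phi> \<and> bij \<phi> \<and>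
     (\<forall>a b. \<phi> (bracket a b) = bracket (\<phi> a) (\<phi> b))"

definition regular_hom_lie :: "('a \<Rightarrow> 'a) \<Rightarrow> bool" where
  "regular_hom_lie \<phi> \<longleftrightarrow> lie_automorphism \<phi> \<and>
     (\<forall>a b c. bracket (bracket a b) (\<phi> c) + bracket (bracket b c) (\<phi> a)
       + bracket (bracket c a) (\<phi> b) = 0)"

definition lie_aut_group :: "('a \<Rightarrow> 'a) monoid" where
  "lie_aut_group = \<lparr>carrier = {\<phi>. lie_automorphism \<phi>}, mult = (\<circ>), one = id\<rparr>"

lemma group_lie_aut_group: "group lie_aut_group"
proof (rule groupI)
  fix \<phi> \<psi> assume "\<phi> \<in> carrier lie_aut_group" "\<psi> \<in> carrier lie_aut_group"
  then show "\<phi> \<otimes>\<^bsub>lie_aut_group\<^esub> \<psi> \<in> carrier lie_aut_group"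
    by (auto simp: lie_aut_group_def lie_automorphism_def bij_comp Vector_Spaces.linear_compose)
next
  show "\<one>\<^bsub>lie_aut_group\<^esub> \<in> carrier lie_aut_group"
    using linear_id by (simp add: lie_aut_group_def lie_automorphism_def id_def[symmetric])
next
  fix \<phi> assume "\<phi> \<in> carrier lie_aut_group"
  then have \<phi>: "Vector_Spaces.linear scale scale \<phi>" "bij \<phi>"
    "\<And>a b. \<phi> (bracket a b) = bracket (\<phi> a) (\<phi> b)"
    by (auto simp: lie_aut_group_def lie_automorphism_def)
  interpret \<phi>: Vector_Spaces.linear scale scale \<phi> by (rule \<phi>)
  have f: "\<phi> (inv_into UNIV \<phi> a) = a" for a using \<phi>(2) by (simp add: bij_is_surj surj_f_inv_f)
  have e: "inv_into UNIV \<phi> a = b \<longleftrightarrow> a = \<phi> b" for a b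
    using \<phi>(2) f by (metis bij_inv_eq_iff)
  have "Vector_Spaces.linear scale scale (inv_into UNIV \<phi>)"
    by unfold_locales (auto simp: e \<phi>.add \<phi>.scale f)
  moreover have "inv_into UNIV \<phi> (bracket a b) = bracket (inv_into UNIV \<phi> a) (inv_into UNIV \<phi> b)" for a b
    by (simp add: e \<phi>(3) f)
  ultimately have "lie_automorphism (inv_into UNIV \<phi>)"
    using \<phi>(2) by (simp add: lie_automorphism_def bij_imp_bij_inv)
  moreover have "inv_into UNIV \<phi> \<circ> \<phi> = id" using \<phi>(2) by (simp add: bij_is_inj)
  ultimately show "\<exists>\<psi>\<in>carrier lie_aut_group. \<psi> \<otimes>\<^bsub>lie_aut_group\<^esub> \<phi> = \<one>\<^bsub>lie_aut_group\<^esub>"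
    by (auto simp: lie_aut_group_def)
qed (auto simp: lie_aut_group_def)

end

definition connected_poset :: "'x::order itself \<Rightarrow> bool" where
  "connected_poset _ \<longleftrightarrow> (\<forall>x y :: 'x. (x, y) \<in> {(u, v). u \<le> v \<or> v \<le> u}\<^sup>*)"

text \<open>An element \<open>f\<close> of the incidence algebra is identified with its coefficient function
  with respect to the basis \<open>e\<^sub>x\<^sub>y\<close>, extended by \<open>0\<close> to all pairs \<open>(x, y)\<close>.\<close>

typedef (overloaded) ('x, 'k) incidence =
  "{f :: 'x::{finite,order} \<Rightarrow> 'x \<Rightarrow> 'k::field. \<forall>x y. \<not> x \<le> y \<longrightarrow> f x y = 0}"
  morphisms coeff Abs_incidence
  by (rule exI[of _ "\<lambda>_ _. 0"]) simp

setup_lifting type_definition_incidence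

lemma coeff_eq_0: "\<not> x \<le> y \<Longrightarrow> coeff f x y = 0"
  using coeff[of f] by simp

lemma incidence_eqI: "(\<And>x y. coeff f x y = coeff g x y) \<Longrightarrow> f = g"
  by (simp add: coeff_inject[symmetric] fun_eq_iff)

instantiation incidence :: ("{finite,order}", field) ring_1
begin

lift_definition zero_incidence :: "('a, 'b) incidence" is "\<lambda>_ _. 0" by simp

lift_definition one_incidence :: "('a, 'b) incidence" is "\<lambda>x y. if x = y then 1 else 0" by auto

lift_definition plus_incidence :: "('a, 'b) incidence \<Rightarrow> ('a, 'b) incidence \<Rightarrow> ('a, 'b) incidence"
  is "\<lambda>f g x y. f x y + g x y" by simp

lift_definition minus_incidence :: "('a, 'b) incidence \<Rightarrow> ('a, 'b) incidence \<Rightarrow> ('a, 'b) incidence"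
  is "\<lambda>f g x y. f x y - g x y" by simp

lift_definition uminus_incidence :: "('a, 'b) incidence \<Rightarrow> ('a, 'b) incidence"
  is "\<lambda>f x y. - f x y" by simp

lift_definition times_incidence :: "('a, 'b) incidence \<Rightarrow> ('a, 'b) incidence \<Rightarrow> ('a, 'b) incidence"
  is "\<lambda>f g x y. \<Sum>z\<in>UNIV. f x z * g z y"
  by (intro allI impI sum.neutral) (metis mult_eq_0_iff order.trans)

instance
proof
  fix a b c :: "('a, 'b) incidence"
  show "a + b + c = a + (b + c)" by transfer (simp add: add.assoc)
  show "a + b = b + a" by transfer (simp add: add.commute)
  show "0 + a = a" by transfer simp
  show "- a + a = 0" by transfer simp
  show "a - b = a + - b" by transfer simp
  show "1 * a = a" by transfer (simp add: if_distrib if_distribR sum.delta cong: if_cong)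
  show "a * 1 = a" by transfer (simp add: if_distrib if_distribR sum.delta' cong: if_cong)
  show "(a + b) * c = a * c + b * c" by transfer (simp add: distrib_right sum.distrib)
  show "a * (b + c) = a * b + a * c" by transfer (simp add: distrib_left sum.distrib)
  show "(0 :: ('a, 'b) incidence) \<noteq> 1" by transfer (auto simp: fun_eq_iff)
  show "a * b * c = a * (b * c)"
  proof (transfer, intro ext)
    fix f g h :: "'a \<Rightarrow> 'a \<Rightarrow> 'b" and x y
    have "(\<Sum>z\<in>UNIV. (\<Sum>w\<in>UNIV. f x w * g w z) * h z y)
        = (\<Sum>z\<in>UNIV. \<Sum>w\<in>UNIV. f x w * (g w z * h z y))"
      by (simp add: sum_distrib_right mult.assoc)
    also have "\<dots> = (\<Sum>w\<in>UNIV. \<Sum>z\<in>UNIV. f x w * (g w z * h z y))"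
      by (rule sum.swap)
    finally show "(\<Sum>z\<in>UNIV. (\<Sum>w\<in>UNIV. f x w * g w z) * h z y)
        = (\<Sum>z\<in>UNIV. f x z * (\<Sum>w\<in>UNIV. g z w * h w y))"
      by (simp add: sum_distrib_left)
  qed
qed

end

lift_definition incidence_scale ::
  "'k::field \<Rightarrow> ('x::{finite,order}, 'k) incidence \<Rightarrow> ('x, 'k) incidence"
  is "\<lambda>r f x y. r * f x y" by simp

lemmas coeff_simps [simp] = zero_incidence.rep_eq one_incidence.rep_eq plus_incidence.rep_eq
  minus_incidence.rep_eq uminus_incidence.rep_eq times_incidence.rep_eq incidence_scale.rep_eq

definition incidence_bracket ::
  "('x::{finite,order}, 'k::field) incidence \<Rightarrow> ('x, 'k) incidence \<Rightarrow> ('x, 'k) incidence" where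
  "incidence_bracket f g = f * g - g * f"

lemma incidence_scale_mult:
  "incidence_scale r f * g = incidence_scale r (f * g)"
  "f * incidence_scale r g = incidence_scale r (f * g)"
  by (rule incidence_eqI; simp add: sum_distrib_left mult_ac)+

interpretation incidence: lie_algebra incidence_scale incidence_bracket
proof
  fix a b c :: "('x::{finite,order}, 'k::field) incidence" and r s :: 'k
  show *: "incidence_scale r (a + b) = incidence_scale r a + incidence_scale r b"
    and "incidence_scale (r + s) a = incidence_scale r a + incidence_scale s a"
    and "incidence_scale r (incidence_scale s a) = incidence_scale (r * s) a"
    and "incidence_scale 1 a = a"
    by (rule incidence_eqI; simp add: algebra_simps)+
  have d: "incidence_scale r (a - b) = incidence_scale r a - incidence_scale r b" for a b :: "('x, 'k) incidence"
    by (rule incidence_eqI) (simp add: algebra_simps)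
  show "incidence_bracket (incidence_scale r a) b = incidence_scale r (incidence_bracket a b)"
    "incidence_bracket a (incidence_scale r b) = incidence_scale r (incidence_bracket a b)"
    by (simp_all add: incidence_bracket_def incidence_scale_mult d)
qed (simp_all add: incidence_bracket_def algebra_simps)

text \<open>The elements \<open>e\<^sub>x\<^sub>y\<close> with \<open>x \<le> y\<close> form a basis with the defining product
  of the incidence algebra.  If \<open>x \<le> y\<close> fails, \<open>e_unit x y\<close> is the dummy value \<open>0\<close>.\<close>

lift_definition e_unit :: "'x::{finite,order} \<Rightarrow> 'x \<Rightarrow> ('x, 'k::field) incidence"
  is "\<lambda>x y u v. if x \<le> y \<and> u = x \<and> v = y then 1 else 0" by auto

lemma e_unit_mult:
  assumes "x \<le> y" "u \<le> v"
  shows "(e_unit x y * e_unit u v :: ('x::{finite,order}, 'k::field) incidence)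
    = (if y = u then e_unit x v else 0)"
proof (rule incidence_eqI)
  fix p q
  have "coeff (e_unit x y * e_unit u v :: ('x, 'k) incidence) p q
     = (\<Sum>z\<in>UNIV. if z = y then (if p = x \<and> z = u \<and> q = v then 1 else 0) else 0)"
    unfolding times_incidence.rep_eq using assms by (intro sum.cong) (auto simp: e_unit.rep_eq)
  also have "\<dots> = (if p = x \<and> y = u \<and> q = v then 1 else 0)" by simp
  also have "\<dots> = coeff (if y = u then e_unit x v else 0 :: ('x, 'k) incidence) p q"
    using assms by (auto simp: e_unit.rep_eq)
  finally show "coeff (e_unit x y * e_unit u v :: ('x, 'k) incidence) p q = \<dots>" .
qed

lemma coeff_sum: "coeff (sum f A) x y = (\<Sum>i\<in>A. coeff (f i) x y)"
  by (induction A rule: infinite_finite_induct) auto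

lemma coeff_e_unit_combination:
  assumes "finite P" "\<And>p. p \<in> P \<Longrightarrow> fst p \<le> snd p"
  shows "coeff (\<Sum>p\<in>P. incidence_scale (c p) (e_unit (fst p) (snd p))) x y
    = (if (x, y) \<in> P then c (x, y) else 0)"
proof -
  have "coeff (\<Sum>p\<in>P. incidence_scale (c p) (e_unit (fst p) (snd p))) x y
    = (\<Sum>p\<in>P. if p = (x, y) then c p else 0)"
    unfolding coeff_sum using assms(2) by (intro sum.cong) (auto simp: e_unit.rep_eq)
  then show ?thesis using assms(1) by simp
qed

lemma inj_e_unit:
  "inj_on (\<lambda>(x, y). e_unit x y :: ('x::{finite,order}, 'k::field) incidence) {(x, y). x \<le> y}"
proof (rule inj_onI, clarify)
  fix x y u v :: 'x assume h: "x \<le> y" "u \<le> v" "(e_unit x y :: ('x, 'k) incidence) = e_unit u v"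
  have "coeff (e_unit u v :: ('x, 'k) incidence) x y = 1"
    unfolding h(3)[symmetric] using h(1) by (simp add: e_unit.rep_eq)
  then show "x = u \<and> y = v" by (auto simp: e_unit.rep_eq split: if_splits)
qed

lemma span_e_unit:
  "incidence.span {e_unit x y |x y. x \<le> y} = (UNIV :: ('x::{finite,order}, 'k::field) incidence set)"
proof -
  have "f \<in> incidence.span {e_unit x y |x y. x \<le> y}" for f :: "('x, 'k) incidence"
  proof -
    have "f = (\<Sum>p\<in>{(x, y). x \<le> y}. incidence_scale (coeff f (fst p) (snd p)) (e_unit (fst p) (snd p)))"
      by (rule incidence_eqI) (subst coeff_e_unit_combination, auto simp: coeff_eq_0)
    also have "\<dots> \<in> incidence.span {e_unit x y |x y. x \<le> y}"
      by (intro incidence.span_sum incidence.span_scale incidence.span_base) (clarsimp, blast)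
    finally show ?thesis .
  qed
  then show ?thesis by auto
qed

lemma independent_e_unit:
  "\<not> incidence.dependent {e_unit x y :: ('x::{finite,order}, 'k::field) incidence |x y. x \<le> y}"
proof -
  let ?P = "{(x, y). x \<le> (y::'x)}"
  let ?e = "\<lambda>p. e_unit (fst p) (snd p) :: ('x, 'k) incidence"
  have inj: "inj_on ?e ?P" using inj_e_unit by (simp add: case_prod_beta')
  have im: "{e_unit x y :: ('x, 'k) incidence |x y. x \<le> y} = ?e ` ?P" by force
  have "\<not> incidence.dependent (?e ` ?P)"
  proof (rule incidence.independent_if_scalars_zero)
    fix c v assume s: "(\<Sum>w\<in>?e ` ?P. incidence_scale (c w) w) = 0" and v: "v \<in> ?e ` ?P"
    from v obtain x y where xy: "x \<le> y" "v = e_unit x y" by auto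
    have "0 = coeff (\<Sum>w\<in>?e ` ?P. incidence_scale (c w) w) x y" by (simp add: s)
    also have "\<dots> = coeff (\<Sum>p\<in>?P. incidence_scale (c (?e p)) (?e p)) x y"
      by (simp add: sum.reindex[OF inj])
    also have "\<dots> = c v"
      using xy by (subst coeff_e_unit_combination) auto
    finally show "c v = 0" by simp
  qed simp
  then show ?thesis by (simp add: im)
qed

end

theory Submission
  imports Defs
begin

text \<open>A Lie automorphism \<open>T\<close> is a regular Hom-Lie structure on the incidence algebra if and only if
  \<open>T c - c\<close> centralizes the derived algebra for all \<open>c\<close>; in any Lie algebra, the automorphisms with
  the latter property form a normal subgroup.  For the nontrivial implication, let \<open>\<alpha>\<^sub>x\<^sub>y\<close> be the
  functional \<open>h \<mapsto> h x x - h y y\<close> on diagonal elements, so that \<open>[h, e\<^sub>x\<^sub>y] = \<alpha>\<^sub>x\<^sub>y(h) e\<^sub>x\<^sub>y\<close>.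
  Since distinct \<open>\<alpha>\<close>s are not proportional, the Hom-Lie identity on two diagonal elements and a root
  vector shows that \<open>[e\<^sub>x\<^sub>y, T h]\<close> is a multiple of \<open>\<alpha>\<^sub>x\<^sub>y(h)\<close>, and on one diagonal element and two
  root vectors it determines \<open>[e\<^sub>x\<^sub>y, T e\<^sub>u\<^sub>v]\<close>.  As \<open>T e\<^sub>x\<^sub>y\<close> is an eigenvector for all \<open>T h\<close>, the
  inclusion-minimal intervals in its support must then be \<open>[x, y]\<close>, with all eigenvalue ratios
  equal to \<open>1\<close>.\<close>

section \<open>Normality for automorphisms trivial modulo the centralizer of the derived
  algebra\<close>

context lie_algebra
begin

definition trivial_mod_centralizer :: "('a \<Rightarrow> 'a) \<Rightarrow> bool" where
  "trivial_mod_centralizer \<phi> \<longleftrightarrow> (\<forall>a b c. bracket (bracket a b) (\<phi> c) = bracket (bracket a b) c)"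

lemma regular_hom_lie_if_trivial_mod_centralizer:
  assumes "lie_automorphism \<phi>" "trivial_mod_centralizer \<phi>"
  shows "regular_hom_lie \<phi>"
  using assms by (simp add: regular_hom_lie_def trivial_mod_centralizer_def jacobi)

text \<open>Conjugation by \<psi> preserves the condition because \<psi> and its inverse map
  brackets to brackets. For products, the two maps are stripped off one after the other.\<close>

lemma normal_trivial_mod_centralizer:
  "{\<phi>. lie_automorphism \<phi> \<and> trivial_mod_centralizer \<phi>} \<lhd> lie_aut_group" (is "?N \<lhd> _")
proof -
  interpret G: group lie_aut_group by (rule group_lie_aut_group)
  have carrier: "carrier lie_aut_group = {\<phi>. lie_automorphism \<phi>}"
    and mult: "\<And>\<phi> \<psi>. \<phi> \<otimes>\<^bsub>lie_aut_group\<^esub> \<psi> = \<phi> \<circ> \<psi>"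
    and one: "\<one>\<^bsub>lie_aut_group\<^esub> = id"
    by (simp_all add: lie_aut_group_def)
  have aut_comp: "lie_automorphism (\<phi> \<circ> \<psi>)" if "lie_automorphism \<phi>" "lie_automorphism \<psi>" for \<phi> \<psi>
    using G.m_closed[of \<phi> \<psi>] that by (simp add: carrier mult)
  have aut_inv: "lie_automorphism (inv\<^bsub>lie_aut_group\<^esub> \<phi>)" if "lie_automorphism \<phi>" for \<phi>
    using G.inv_closed[of \<phi>] that by (simp add: carrier)
  have inv_right: "\<phi> ((inv\<^bsub>lie_aut_group\<^esub> \<phi>) a) = a" if "lie_automorphism \<phi>" for \<phi> a
    using G.r_inv[of \<phi>] that by (simp add: carrier mult one fun_eq_iff)
  show ?thesis
  proof (subst G.normal_inv_iff, intro conjI ballI G.subgroupI)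
    show "?N \<noteq> {}"
      using G.one_closed by (auto simp: carrier one trivial_mod_centralizer_def)
  next
    fix \<phi> assume "\<phi> \<in> ?N"
    then show "inv\<^bsub>lie_aut_group\<^esub> \<phi> \<in> ?N"
      \<comment> \<open>Use the condition for \<phi> at the preimage of \<open>c\<close>.\<close>
      using aut_inv inv_right unfolding trivial_mod_centralizer_def mem_Collect_eq by metis
  next
    fix \<phi> \<psi> assume "\<phi> \<in> ?N" "\<psi> \<in> ?N"
    then show "\<phi> \<otimes>\<^bsub>lie_aut_group\<^esub> \<psi> \<in> ?N"
      by (simp add: mult aut_comp trivial_mod_centralizer_def)
  next
    fix \<psi> \<phi> assume \<psi>: "\<psi> \<in> carrier lie_aut_group" and \<phi>: "\<phi> \<in> ?N"
    let ?\<psi>' = "inv\<^bsub>lie_aut_group\<^esub> \<psi>"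
    have \<psi>_aut: "lie_automorphism \<psi>" using \<psi> by (simp add: carrier)
    have hom: "\<psi> (bracket a b) = bracket (\<psi> a) (\<psi> b)" for a b
      using \<psi>_aut by (simp add: lie_automorphism_def)
    have "bracket (bracket a b) (\<psi> (\<phi> (?\<psi>' c))) = bracket (bracket a b) c" for a b c
    proof -
      have "bracket (bracket a b) (\<psi> (\<phi> (?\<psi>' c)))
          = \<psi> (bracket (bracket (?\<psi>' a) (?\<psi>' b)) (\<phi> (?\<psi>' c)))"
        by (simp add: hom inv_right \<psi>_aut)
      also have "\<dots> = \<psi> (bracket (bracket (?\<psi>' a) (?\<psi>' b)) (?\<psi>' c))"
        using \<phi> by (simp add: trivial_mod_centralizer_def)
      also have "\<dots> = bracket (bracket a b) c"
        by (simp add: hom inv_right \<psi>_aut)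
      finally show ?thesis .
    qed
    then show "\<psi> \<otimes>\<^bsub>lie_aut_group\<^esub> \<phi> \<otimes>\<^bsub>lie_aut_group\<^esub> ?\<psi>' \<in> ?N"
      using \<phi> by (simp add: mult aut_comp aut_inv \<psi>_aut trivial_mod_centralizer_def)
  qed (auto simp: carrier)
qed

end

section \<open>Induction over the basis; coefficients and brackets of basis elements\<close>

lemma incidence_induct [case_names e_unit add scale]:
  fixes f :: "('x::{finite,order}, 'k::field) incidence"
  assumes e: "\<And>x y. x \<le> y \<Longrightarrow> P (e_unit x y)"
    and add: "\<And>f g. P f \<Longrightarrow> P g \<Longrightarrow> P (f + g)"
    and scale: "\<And>r f. P f \<Longrightarrow> P (incidence_scale r f)"
  shows "P f"
proof -
  have "f \<in> incidence.span {e_unit x y |x y. x \<le> y}" by (simp add: span_e_unit)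
  then show ?thesis
  proof (induction rule: incidence.span_induct_alt)
    case base
    \<comment> \<open>Zero is obtained as 0 times an arbitrary idempotent.\<close>
    show ?case using scale[of "e_unit undefined undefined" 0] e by simp
  next
    case (step c g f)
    then show ?case using e add scale by blast
  qed
qed

lemma coeff_e_unit_mult:
  "x \<le> y \<Longrightarrow> coeff (e_unit x y * f) p q = (if p = x then coeff f y q else 0)"
  by (simp add: e_unit.rep_eq sum.delta if_distrib[of "\<lambda>x. x * _"] cong: if_cong)

lemma coeff_mult_e_unit:
  "x \<le> y \<Longrightarrow> coeff (f * e_unit x y) p q = (if q = y then coeff f p x else 0)"
  by (simp add: e_unit.rep_eq sum.delta' if_distrib[of "\<lambda>x. _ * x"] cong: if_cong)

lemma coeff_bracket_e_unit:
  assumes "x \<le> y"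
  shows "coeff (incidence_bracket (e_unit x y) f) p q
    = (if p = x then coeff f y q else 0) - (if q = y then coeff f p x else 0)"
  using assms by (simp add: incidence_bracket_def coeff_e_unit_mult coeff_mult_e_unit del: times_incidence.rep_eq)

text \<open>By antisymmetry of the order, only z = p contributes to either product at (p, p), and
  there the scalars commute.\<close>

lemma coeff_bracket_diag: "coeff (incidence_bracket f g) p p = 0"
proof -
  have "coeff f p z * coeff g z p = coeff g p z * coeff f z p" for z
  proof (cases "z = p")
    case False
    then have "\<not> p \<le> z \<or> \<not> z \<le> p" by auto
    then show ?thesis by (elim disjE) (simp_all add: coeff_eq_0)
  qed simp
  then show ?thesis by (simp add: incidence_bracket_def)
qed

text \<open>The value of \<open>\<alpha>\<^sub>x\<^sub>y\<close> at the idempotent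
  \<open>e_unit z z\<close>.\<close>

definition root :: "'x \<Rightarrow> 'x \<Rightarrow> 'x \<Rightarrow> 'k::field" where
  "root x y z = of_bool (z = x) - of_bool (z = y)"

lemma root_eq_0: "z \<noteq> x \<Longrightarrow> z \<noteq> y \<Longrightarrow> root x y z = 0"
  by (simp add: root_def)

lemma bracket_idempotent:
  "x \<le> y \<Longrightarrow> incidence_bracket (e_unit z z) (e_unit x y)
    = incidence_scale (root x y z) (e_unit x y)"
  by (rule incidence_eqI) (auto simp: coeff_bracket_e_unit e_unit.rep_eq root_def)

lemma bracket_e_unit:
  assumes "x \<le> y" "u \<le> v"
  shows "incidence_bracket (e_unit x y) (e_unit u v)
    = (if y = u then e_unit x v else 0) - (if v = x then e_unit u y else 0)"
  using assms by (simp add: incidence_bracket_def e_unit_mult)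

lemma bracket_commute: "incidence_bracket f g = - incidence_bracket g f"
  by (simp add: incidence_bracket_def)

lemma bracket_minus_left: "incidence_bracket (- f) g = - incidence_bracket f g"
  by (simp add: incidence_bracket_def)

lemma bracket_idempotent_right:
  assumes "x \<le> y"
  shows "incidence_bracket (e_unit x y) (e_unit z z) = - incidence_scale (root x y z) (e_unit x y)"
  by (subst bracket_commute) (simp add: bracket_idempotent[OF assms])

section \<open>The Hom-Lie identity on idempotents and root vectors\<close>

context
  fixes T :: "('x::{finite,order}, 'k::field) incidence \<Rightarrow> ('x, 'k) incidence"
  assumes T: "incidence.regular_hom_lie T"
begin

lemma hom_lie_identity:
  "incidence_bracket (incidence_bracket a b) (T c) + incidence_bracket (incidence_bracket b c) (T a)
    + incidence_bracket (incidence_bracket c a) (T b) = 0"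
  using T by (simp add: incidence.regular_hom_lie_def)

lemma T_linear: "Vector_Spaces.linear incidence_scale incidence_scale T"
  and T_bij: "bij T"
  and T_bracket: "T (incidence_bracket a b) = incidence_bracket (T a) (T b)"
  using T by (auto simp: incidence.regular_hom_lie_def incidence.lie_automorphism_def)

lemma T_add: "T (a + b) = T a + T b"
  and T_scale: "T (incidence_scale r a) = incidence_scale r (T a)"
  using T_linear unfolding Vector_Spaces.linear_iff by blast+

lemma T_eq_0_iff: "T a = 0 \<longleftrightarrow> a = 0"
proof -
  have "T 0 = 0" using T_add[of 0 0] by simp
  then show ?thesis using T_bij by (metis bij_is_inj injD)
qed

text \<open>The idempotents commute, so one of the three terms vanishes. The other two force
  \<open>[e\<^sub>x\<^sub>y, T e\<^sub>z\<^sub>z]\<close>, as a function of z, to be proportional to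
  the root.\<close>

lemma hom_lie_two_idempotents:
  assumes "x \<le> y"
  shows "root x y z' * coeff (incidence_bracket (e_unit x y) (T (e_unit z z))) p q
    = root x y z * coeff (incidence_bracket (e_unit x y) (T (e_unit z' z'))) p q"
proof -
  have "incidence_bracket (e_unit z z) (e_unit z' z') = (0 :: ('x, 'k) incidence)"
    by (auto simp: bracket_e_unit)
  then have "incidence_bracket 0 (T (e_unit x y))
      + incidence_scale (root x y z') (incidence_bracket (e_unit x y) (T (e_unit z z)))
      - incidence_scale (root x y z) (incidence_bracket (e_unit x y) (T (e_unit z' z'))) = 0"
    using hom_lie_identity[of "e_unit z z" "e_unit z' z'" "e_unit x y"]
    by (simp add: bracket_idempotent[OF assms] bracket_idempotent_right[OF assms]
        incidence.bracket_scale_left bracket_minus_left)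
  from arg_cong[OF this, of "\<lambda>f. coeff f p q"] show ?thesis
    by (simp add: incidence_bracket_def)
qed

lemma hom_lie_one_idempotent:
  assumes "x \<le> y" "u \<le> v"
  shows "incidence_scale (root x y z) (incidence_bracket (e_unit x y) (T (e_unit u v)))
    + incidence_bracket (incidence_bracket (e_unit x y) (e_unit u v)) (T (e_unit z z))
    = incidence_scale (root u v z) (incidence_bracket (e_unit u v) (T (e_unit x y)))"
  using hom_lie_identity[of "e_unit z z" "e_unit x y" "e_unit u v"]
  by (simp add: bracket_idempotent[OF assms(1)] bracket_idempotent_right[OF assms(2)]
      incidence.bracket_scale_left bracket_minus_left)

text \<open>The proportionality vector of \<open>[e\<^sub>x\<^sub>y, T e\<^sub>z\<^sub>z]\<close>
  for x < y, normalized at z = x, where the root is 1. For T = id it is \<open>- e_unit x y\<close>,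
  which explains the signs below.\<close>

definition w :: "'x \<Rightarrow> 'x \<Rightarrow> ('x, 'k) incidence" where
  "w x y = incidence_bracket (e_unit x y) (T (e_unit x x))"

lemma bracket_T_idempotent:
  assumes "x < y"
  shows "incidence_bracket (e_unit x y) (T (e_unit z z)) = incidence_scale (root x y z) (w x y)"
proof (rule incidence_eqI)
  fix p q
  have "root x y x = (1::'k)" using assms by (simp add: root_def)
  then show "coeff (incidence_bracket (e_unit x y) (T (e_unit z z))) p q
      = coeff (incidence_scale (root x y z) (w x y)) p q"
    using hom_lie_two_idempotents[of x y x z p q] assms by (simp add: w_def)
qed

lemma bracket_T_orthogonal:
  assumes "x < y" "u < v" "y \<noteq> u" "v \<noteq> x" "(x, y) \<noteq> (u, v)"
  shows "incidence_bracket (e_unit x y) (T (e_unit u v)) = 0"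
proof -
  \<comment> \<open>Distinct roots are separated by an endpoint of [x, y]: take y if the left
    endpoints agree, and x otherwise.\<close>
  obtain z where z: "root x y z \<noteq> (0::'k)" "root u v z = (0::'k)"
  proof (cases "x = u")
    case True
    then show ?thesis using assms by (intro that[of y]) (auto simp: root_def)
  next
    case False
    then show ?thesis using assms by (intro that[of x]) (auto simp: root_def)
  qed
  have "incidence_bracket (e_unit x y) (e_unit u v) = (0 :: ('x, 'k) incidence)"
    using assms by (simp add: bracket_e_unit)
  then have "incidence_scale (root x y z) (incidence_bracket (e_unit x y) (T (e_unit u v))) = 0"
    using hom_lie_one_idempotent[of x y u v z] assms z(2)
    by (simp add: incidence_bracket_def)
  then show ?thesis using z(1) by simp
qed

lemma bracket_T_left:
  assumes "x < y" "y < v"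
  shows "incidence_bracket (e_unit x y) (T (e_unit y v)) = - w x v"
proof -
  have "incidence_bracket (e_unit x y) (e_unit y v) = (e_unit x v :: ('x, 'k) incidence)"
    using assms by (auto simp: bracket_e_unit)
  \<comment> \<open>The choice z = x kills the root of (y, v), leaving
    \<open>[e\<^sub>x\<^sub>y, T e\<^sub>y\<^sub>v]\<close> and a bracket with
    \<open>e_unit x v\<close>.\<close>
  moreover have "root x y x = (1::'k)" "root y v x = (0::'k)" using assms by (auto simp: root_def)
  ultimately show ?thesis
    using hom_lie_one_idempotent[of x y y v x] assms by (simp add: w_def eq_neg_iff_add_eq_0)
qed

lemma bracket_T_right:
  assumes "x < y" "y < v"
  shows "incidence_bracket (e_unit y v) (T (e_unit x y)) = w x v"
proof -
  have "x < v" using assms by simp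
  have "incidence_bracket (e_unit x y) (e_unit y v) = (e_unit x v :: ('x, 'k) incidence)"
    using assms by (auto simp: bracket_e_unit)
  moreover have "root x y v = (0::'k)" "root y v v = (-1::'k)" "root x v v = (-1::'k)"
    using assms by (auto simp: root_def)
  ultimately show ?thesis
    using hom_lie_one_idempotent[of x y y v v] bracket_T_idempotent[OF \<open>x < v\<close>, of v] assms
    by simp
qed

section \<open>Eigenvector equations and the support of \<open>T (e_unit x y)\<close>\<close>

lemma T_idempotent_diag:
  assumes "x < y"
  shows "coeff (T (e_unit z z)) x x - coeff (T (e_unit z z)) y y = - coeff (w x y) x y * root x y z"
proof -
  \<comment> \<open>Compare coefficients at (x, y). The scalar \<open>- coeff (w x y) x y\<close> is
    the eigenvalue ratio, shown to be 1 in \<open>coeff_w_self\<close>.\<close>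
  have "coeff (T (e_unit z z)) y y - coeff (T (e_unit z z)) x x = root x y z * coeff (w x y) x y"
    using arg_cong[OF bracket_T_idempotent[OF assms, of z], of "\<lambda>f. coeff f x y"] assms
    by (simp add: coeff_bracket_e_unit)
  then show ?thesis by (simp add: algebra_simps)
qed

lemma T_eigen:
  assumes "x < y"
  shows "incidence_bracket (T (e_unit z z)) (T (e_unit x y)) = incidence_scale (root x y z) (T (e_unit x y))"
  using assms by (simp add: T_bracket[symmetric] bracket_idempotent T_scale)

lemma T_eigen_coeff:
  assumes "x < y"
  shows "(\<Sum>r\<in>UNIV. coeff (T (e_unit z z)) p r * coeff (T (e_unit x y)) r q)
    - (\<Sum>r\<in>UNIV. coeff (T (e_unit x y)) p r * coeff (T (e_unit z z)) r q)
    = root x y z * coeff (T (e_unit x y)) p q"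
  using arg_cong[OF T_eigen[OF assms, of z], of "\<lambda>f. coeff f p q"]
  by (simp add: incidence_bracket_def)

lemma T_e_unit_diag:
  assumes "x < y"
  shows "coeff (T (e_unit x y)) p p = 0"
proof -
  have "root x y x = (1::'k)" using assms by (simp add: root_def)
  then have "T (e_unit x y) = incidence_bracket (T (e_unit x x)) (T (e_unit x y))"
    using T_eigen[OF assms, of x] by simp
  then show ?thesis using coeff_bracket_diag by metis
qed

text \<open>Induction on the size of [p, q]. A smaller support interval inside it already contains
  [x, y] and yields the ratio, so only minimal support intervals need work.\<close>

lemma T_support_and_ratio:
  assumes xy: "x < y" and "coeff (T (e_unit x y)) p q \<noteq> 0"
  shows "p \<le> x \<and> y \<le> q \<and> coeff (w x y) x y = -1"
  using assms(2)
proof (induction "card {p..q}" arbitrary: p q rule: less_induct)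
  case less
  let ?g = "coeff (T (e_unit x y))"
  have pq: "p < q" using less.prems T_e_unit_diag[OF xy] coeff_eq_0 by (metis order_le_less)
  show ?case
  proof (cases "\<exists>p' q'. p \<le> p' \<and> q' \<le> q \<and> (p', q') \<noteq> (p, q) \<and> ?g p' q' \<noteq> 0")
    case True
    then obtain p' q' where *: "p \<le> p'" "q' \<le> q" "(p', q') \<noteq> (p, q)" "?g p' q' \<noteq> 0" by blast
    have "p' \<le> q'" using *(4) coeff_eq_0 by blast
    then have "{p'..q'} \<subset> {p..q}" using * by (auto simp: psubset_eq set_eq_iff) (metis order.refl order.trans order.antisym)+
    then have "card {p'..q'} < card {p..q}" by (simp add: psubset_card_mono)
    from less.hyps[OF this *(4)] show ?thesis using * by (meson order.trans)
  next
    case False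
    \<comment> \<open>By minimality, only the diagonal coefficients of \<open>T (e_unit z z)\<close>
      enter the eigenvector equation at (p, q), and the nonzero coefficient there cancels.\<close>
    have eig: "- coeff (w p q) p q * root p q z = root x y z" for z
    proof -
      let ?f = "coeff (T (e_unit z z))"
      have 1: "?f p r * ?g r q = (if r = p then ?f p p * ?g p q else 0)" for r
        using False coeff_eq_0[of p r] by (cases "p \<le> r") auto
      have 2: "?g p r * ?f r q = (if r = q then ?g p q * ?f q q else 0)" for r
        using False coeff_eq_0[of r q] by (cases "r \<le> q") auto
      have "?f p p * ?g p q - ?g p q * ?f q q = root x y z * ?g p q"
        using T_eigen_coeff[OF xy, of z p q] unfolding sum.cong[OF refl 1] sum.cong[OF refl 2] by simp
      then have "(?f p p - ?f q q) * ?g p q = root x y z * ?g p q"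
        by (simp add: algebra_simps)
      then show ?thesis using less.prems unfolding T_idempotent_diag[OF pq] mult_cancel_right by blast
    qed
    have root: "root x y x = (1::'k)" "root x y y = (-1::'k)" using xy by (auto simp: root_def)
    \<comment> \<open>Both x and y lie in {p, q}. The order, not the sign of the root, then excludes
      x = q and y = p, so characteristic 2 is covered.\<close>
    then have "root p q x \<noteq> (0::'k)" "root p q y \<noteq> (0::'k)" using eig[of x] eig[of y] by auto
    then have "x = p \<or> x = q" "y = p \<or> y = q" using root_eq_0 by metis+
    then have "p = x" "q = y" using xy pq by auto
    then show ?thesis using eig[of x] root by (simp add: minus_equation_iff)
  qed
qed

lemma T_support:
  assumes "x < y" "coeff (T (e_unit x y)) p q \<noteq> 0"
  shows "p \<le> x" "y \<le> q"
  using T_support_and_ratio[OF assms] by auto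

lemma coeff_w_self:
  assumes "x < y"
  shows "coeff (w x y) x y = -1"
proof -
  have "coeff (e_unit x y :: ('x, 'k) incidence) x y = 1" using assms by (simp add: e_unit.rep_eq)
  then have "T (e_unit x y) \<noteq> 0" by (auto simp: T_eq_0_iff)
  then obtain p q where "coeff (T (e_unit x y)) p q \<noteq> 0"
    by (metis incidence_eqI zero_incidence.rep_eq)
  then show ?thesis using T_support_and_ratio[OF assms] by blast
qed

lemma T_idempotent_diag':
  assumes "x < y"
  shows "coeff (T (e_unit z z)) x x - coeff (T (e_unit z z)) y y = root x y z"
  using T_idempotent_diag[OF assms] coeff_w_self[OF assms] by simp

text \<open>Two expressions for \<open>w x v\<close>: the one through \<open>T (e_unit y v)\<close>
  lives in row x, the one through \<open>T (e_unit x y)\<close> in column v. Only the entry at (x,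
  v) survives.\<close>

lemma w_composite:
  assumes "x < y" "y < v"
  shows "w x v = - e_unit x v"
proof (rule incidence_eqI)
  fix p q
  have xv: "x < v" using assms by simp
  have "coeff (T (e_unit y v)) p x = 0" using T_support(2)[OF assms(2), of p x] xv leD by blast
  then have 1: "coeff (w x v) p q = (if p = x then - coeff (T (e_unit y v)) y q else 0)"
    using arg_cong[OF bracket_T_left[OF assms], of "\<lambda>f. - coeff f p q"] assms
    by (auto simp: coeff_bracket_e_unit split: if_splits)
  have "coeff (T (e_unit x y)) v q = 0" using T_support(1)[OF assms(1), of v q] xv leD by blast
  then have 2: "coeff (w x v) p q = (if q = v then - coeff (T (e_unit x y)) p y else 0)"
    using arg_cong[OF bracket_T_right[OF assms], of "\<lambda>f. coeff f p q"] assms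
    by (auto simp: coeff_bracket_e_unit split: if_splits)
  show "coeff (w x v) p q = coeff (- e_unit x v) p q"
    using 1 2 coeff_w_self[OF xv] xv by (auto simp: e_unit.rep_eq)
qed

section \<open>Coefficients of T at non-extremal elements\<close>

lemma T_coeff_self_if_not_maximal:
  assumes "x < y" "y < v"
  shows "coeff (T (e_unit x y)) x y = 1"
proof -
  have "x < v" using assms by simp
  then show ?thesis
    using arg_cong[OF bracket_T_right[OF assms], of "\<lambda>f. coeff f x v"] assms w_composite[OF assms]
    by (simp add: coeff_bracket_e_unit e_unit.rep_eq order_less_imp_not_eq)
qed

lemma T_coeff_self_if_not_minimal:
  assumes "u < x" "x < y"
  shows "coeff (T (e_unit x y)) x y = 1"
proof -
  have "u < y" using assms by simp
  then show ?thesis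
    using arg_cong[OF bracket_T_left[OF assms], of "\<lambda>f. coeff f u y"] assms w_composite[OF assms]
    by (simp add: coeff_bracket_e_unit e_unit.rep_eq order_less_imp_not_eq2)
qed

text \<open>The support lemma leaves columns at or above y. Bracketing with
  \<open>e_unit z v\<close>, which is orthogonal to \<open>e_unit x y\<close>, removes column
  z.\<close>

lemma T_e_unit_nonmaximal:
  assumes "x < y" "y < z" "z < v"
  shows "coeff (T (e_unit x y)) p z = 0"
proof -
  have "incidence_bracket (e_unit z v) (T (e_unit x y)) = 0"
    using assms by (intro bracket_T_orthogonal) auto
  from arg_cong[OF this, of "\<lambda>f. coeff f p v"] show ?thesis
    using assms T_e_unit_diag[OF assms(1), of v] by (auto simp: coeff_bracket_e_unit split: if_splits)
qed

lemma T_e_unit_nonminimal: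
  assumes "u < z" "z < x" "x < y"
  shows "coeff (T (e_unit x y)) z q = 0"
proof -
  have "incidence_bracket (e_unit u z) (T (e_unit x y)) = 0"
    using assms by (intro bracket_T_orthogonal) auto
  from arg_cong[OF this, of "\<lambda>f. coeff f u q"] show ?thesis
    using assms T_e_unit_diag[OF assms(3), of u] by (auto simp: coeff_bracket_e_unit split: if_splits)
qed

text \<open>The coefficient is computed twice: from the eigenvector equation at (x, v), and from
  \<open>bracket_T_idempotent\<close> as a multiple of the root of (x, y).\<close>

lemma T_idempotent_above:
  assumes "x < y" "y < v"
  shows "coeff (T (e_unit z z)) y v = 0"
proof -
  let ?g = "coeff (T (e_unit x y))"
  have xv: "x < v" using assms by simp
  have 1: "coeff (T (e_unit z z)) y v = (root x v z - root x y z) * ?g x v" for z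
  proof -
    let ?f = "coeff (T (e_unit z z))"
    have f_g: "?f x r * ?g r v = (if r = x then ?f x x * ?g x v else 0)" for r
      using T_support(1)[OF assms(1), of r v] coeff_eq_0[of x r] by (cases "x \<le> r") auto
    have g_f: "?g x r * ?f r v
        = (if r = y then ?f y v else 0) + (if r = v then ?g x v * ?f v v else 0)" for r
    proof (cases "y < r \<and> r < v")
      case True
      then show ?thesis using T_e_unit_nonmaximal[of x y r v x] assms by auto
    next
      case False
      then show ?thesis
        using T_support(2)[OF assms(1), of x r] coeff_eq_0[of r v] T_coeff_self_if_not_maximal[OF assms] assms
        by (cases "y \<le> r"; cases "r \<le> v") (auto simp: order_le_less)
    qed
    have "?f x x * ?g x v - (?f y v + ?g x v * ?f v v) = root x y z * ?g x v"
      using T_eigen_coeff[OF assms(1), of z x v]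
      unfolding sum.cong[OF refl f_g] sum.cong[OF refl g_f] by (simp add: sum.distrib)
    then have "?f y v = (?f x x - ?f v v) * ?g x v - root x y z * ?g x v"
      by (simp add: algebra_simps)
    then show ?thesis using T_idempotent_diag'[OF xv, of z] by (simp add: algebra_simps)
  qed
  have 2: "coeff (T (e_unit z z)) y v = root x y z * coeff (w x y) x v" for z
    using arg_cong[OF bracket_T_idempotent[OF assms(1), of z], of "\<lambda>f. coeff f x v"] assms
    by (simp add: coeff_bracket_e_unit order_less_imp_not_eq2)
  \<comment> \<open>At z = x both roots in the first formula are 1, so it gives 0, while the second
    gives the coefficient of \<open>w x y\<close> itself.\<close>
  have "coeff (w x y) x v = 0" using 1[of x] 2[of x] assms xv
    by (simp add: root_def order_less_imp_not_eq)
  then show ?thesis using 2 by simp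
qed

lemma T_idempotent_below:
  assumes "u < x" "x < y"
  shows "coeff (T (e_unit z z)) u x = 0"
proof -
  let ?g = "coeff (T (e_unit x y))"
  have uy: "u < y" using assms by simp
  have 1: "coeff (T (e_unit z z)) u x = (root x y z - root u y z) * ?g u y" for z
  proof -
    let ?f = "coeff (T (e_unit z z))"
    have g_f: "?g u r * ?f r y = (if r = y then ?g u y * ?f y y else 0)" for r
      using T_support(2)[OF assms(2), of u r] coeff_eq_0[of r y] by (cases "r \<le> y") auto
    have f_g: "?f u r * ?g r y
        = (if r = x then ?f u x else 0) + (if r = u then ?f u u * ?g u y else 0)" for r
    proof (cases "u < r \<and> r < x")
      case True
      then show ?thesis using T_e_unit_nonminimal[of u r x y y] assms by auto
    next
      case False
      then show ?thesis
        using T_support(1)[OF assms(2), of r y] coeff_eq_0[of u r] T_coeff_self_if_not_minimal[OF assms] assms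
        by (cases "u \<le> r"; cases "r \<le> x") (auto simp: order_le_less)
    qed
    have "?f u x + ?f u u * ?g u y - ?g u y * ?f y y = root x y z * ?g u y"
      using T_eigen_coeff[OF assms(2), of z u y]
      unfolding sum.cong[OF refl f_g] sum.cong[OF refl g_f] by (simp add: sum.distrib)
    then have "?f u x = root x y z * ?g u y - (?f u u - ?f y y) * ?g u y"
      by (simp add: algebra_simps)
    then show ?thesis using T_idempotent_diag'[OF uy, of z] by (simp add: algebra_simps)
  qed
  have 2: "- coeff (T (e_unit z z)) u x = root x y z * coeff (w x y) u y" for z
    using arg_cong[OF bracket_T_idempotent[OF assms(2), of z], of "\<lambda>f. coeff f u y"] assms
    by (simp add: coeff_bracket_e_unit order_less_imp_not_eq)
  \<comment> \<open>Dually, both roots are -1 at z = y.\<close>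
  have "coeff (w x y) u y = 0" using 1[of y] 2[of y] assms uy
    by (simp add: root_def order_less_imp_not_eq2)
  then show ?thesis using 2[of z] by simp
qed

section \<open>Agreement of T with the identity inside brackets with the derived algebra\<close>

lemma bracket_T_e_unit:
  assumes xy: "x < y" and uv: "u \<le> v"
  shows "incidence_bracket (e_unit x y) (T (e_unit u v)) = incidence_bracket (e_unit x y) (e_unit u v)"
proof (cases "u = v")
  case True
  \<comment> \<open>The bracket with \<open>e_unit x y\<close> sees only row y and column x. Since y
    is not minimal and x not maximal, both are diagonal.\<close>
  have "coeff (T (e_unit u u)) y q = 0" if "y \<noteq> q" for q
    using T_idempotent_above[OF xy, of q u] that coeff_eq_0[of y q] by (cases "y \<le> q") auto
  moreover have "coeff (T (e_unit u u)) p x = 0" if "p \<noteq> x" for p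
    using T_idempotent_below[OF _ xy, of p u] that coeff_eq_0[of p x] by (cases "p \<le> x") auto
  ultimately show ?thesis
    using T_idempotent_diag'[OF xy, of u] xy unfolding True[symmetric]
    by (intro incidence_eqI) (auto simp: coeff_bracket_e_unit e_unit.rep_eq root_def algebra_simps)
next
  case False
  then have uv: "u < v" using uv by simp
  consider "(u, v) = (x, y)" | "y = u" | "v = x" | "(x, y) \<noteq> (u, v)" "y \<noteq> u" "v \<noteq> x" by blast
  then show ?thesis
  proof cases
    case 1
    then have "coeff (T (e_unit u v)) y q = 0" "coeff (T (e_unit u v)) p x = 0" for p q
      using T_support(1)[OF xy, of y q] T_support(2)[OF xy, of p x] xy leD by auto
    then show ?thesis
      using 1 xy by (intro incidence_eqI) (simp add: coeff_bracket_e_unit e_unit.rep_eq)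
  next
    case 2
    then show ?thesis using bracket_T_left[of x y v] w_composite[of x y v] xy uv
      by (auto simp: bracket_e_unit)
  next
    case 3
    then show ?thesis using bracket_T_right[of u v y] w_composite[of u v y] xy uv
      by (auto simp: bracket_e_unit)
  next
    case 4
    then show ?thesis using bracket_T_orthogonal[of x y u v] xy uv by (simp add: bracket_e_unit)
  qed
qed

lemma trivial_mod_centralizer_T: "incidence.trivial_mod_centralizer T"
proof -
  have 1: "incidence_bracket (e_unit x y) (T c) = incidence_bracket (e_unit x y) c" if "x < y" for x y c
    using that by (induction c rule: incidence_induct)
      (simp_all add: bracket_T_e_unit T_add T_scale incidence.bracket_add_right incidence.bracket_scale_right)
  have 2: "incidence_bracket (incidence_bracket (e_unit x y) (e_unit u v)) (T c)
      = incidence_bracket (incidence_bracket (e_unit x y) (e_unit u v)) c"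
    if "x \<le> y" "u \<le> v" for x y u v c
  proof -
    \<comment> \<open>A bracket of basis elements is 0 or plus or minus a strict root vector; if y =
      u and v = x, antisymmetry makes all four points equal.\<close>
    consider "y = u" "v = x" | "y = u" "v \<noteq> x" | "y \<noteq> u" "v = x" | "y \<noteq> u" "v \<noteq> x" by blast
    then show ?thesis
    proof cases
      case 2
      then have "x < v" using that by auto
      then show ?thesis using 1 2 that by (simp add: bracket_e_unit)
    next
      case 3
      then have "u < y" using that by auto
      then have "incidence_bracket (- e_unit u y) (T c) = incidence_bracket (- e_unit u y) c"
        using 1[of u y c] by (simp add: incidence_bracket_def algebra_simps)
      then show ?thesis using 3 that by (simp add: bracket_e_unit)
    qed (use that in \<open>simp_all add: bracket_e_unit, simp_all add: incidence_bracket_def\<close>)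
  qed
  have 3: "incidence_bracket (incidence_bracket (e_unit x y) b) (T c)
      = incidence_bracket (incidence_bracket (e_unit x y) b) c" if "x \<le> y" for x y b c
    using that by (induction b rule: incidence_induct)
      (simp_all add: 2 incidence.bracket_add_left incidence.bracket_scale_left
        incidence.bracket_add_right incidence.bracket_scale_right)
  have "incidence_bracket (incidence_bracket a b) (T c) = incidence_bracket (incidence_bracket a b) c" for a b c
    by (induction a rule: incidence_induct)
      (simp_all add: 3 incidence.bracket_add_left incidence.bracket_scale_left)
  then show ?thesis by (simp add: incidence.trivial_mod_centralizer_def)
qed

end

theorem corollary2p15:
  assumes "connected_poset TYPE('x::{finite,order})"
    and "card (UNIV :: 'x set) > 1"
  shows "{\<phi> :: ('x, 'k::field) incidence \<Rightarrow> ('x, 'k) incidence. incidence.regular_hom_lie \<phi>}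
           \<lhd> incidence.lie_aut_group"
proof -
  have "incidence.regular_hom_lie \<phi> \<longleftrightarrow>
      incidence.lie_automorphism \<phi> \<and> incidence.trivial_mod_centralizer \<phi>"
    for \<phi> :: "('x, 'k) incidence \<Rightarrow> ('x, 'k) incidence"
    using trivial_mod_centralizer_T incidence.regular_hom_lie_if_trivial_mod_centralizer
    unfolding incidence.regular_hom_lie_def by blast
  then show ?thesis using incidence.normal_trivial_mod_centralizer by simp
qed

end
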